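(* For each integer $m\geq 0$ the following three identities hold, where $L_k$ denotes the $k$-th Lucas number: $$\frac{\pi}{6} = \sum_{n=0}^\infty \frac{(-1)^n}{2n+1} L_{2m(2n+1)} \Big (\frac{2}{\sqrt{3}L_{2m} + \sqrt{3 L_{2m}^2+4}}\Big )^{2n+1},$$ $$\frac{\pi}{12} = \sum_{n=0}^\infty \frac{(-1)^n}{2n+1} L_{2m(2n+1)} \Big (\frac{2(2-\sqrt{3})}{L_{2m} + \sqrt{L_{2m}^2+4(2-\sqrt{3})^2}}\Big )^{2n+1},$$ and $$\frac{\pi}{5} = \sum_{n=0}^\infty \frac{(-1)^n}{2n+1} L_{2m(2n+1)} \Big (\frac{2\sqrt{5-2\sqrt{5}}}{L_{2m} + \sqrt{L_{2m}^2+4(5-2\sqrt{5})}}\Big )^{2n+1}.$$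
   Context: The Lucas numbers are defined by $L_0=2$, $L_1=1$, and $L_{n+2}=L_{n+1}+L_n$ for $n\ge 0$. *)

theory Defs
  imports Complex_Main
begin

fun lucas :: "nat \<Rightarrow> nat" where
  "lucas 0 = 2"
| "lucas (Suc 0) = 1"
| "lucas (Suc (Suc n)) = lucas (Suc n) + lucas n"

end

theory Submission
  imports Defs
begin

text \<open>
  With \<open>\<phi>\<close> the golden ratio, \<open>a = \<phi>\<^sup>2\<^sup>m\<close> and \<open>b = 1 / a\<close>, Binet's formula gives
  \<open>L\<^sub>2\<^sub>m\<^sub>k = a\<^sup>k + b\<^sup>k\<close>. Hence each series at argument \<open>x\<close> is
  \<open>arctan (a x) + arctan (b x)\<close>, whose tangent is \<open>(a + b) x / (1 - x\<^sup>2)\<close>. The given \<open>x\<close> is the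
  positive root of \<open>t x\<^sup>2 + L\<^sub>2\<^sub>m x - t = 0\<close>, so this tangent is \<open>t\<close>, which is in turn the
  tangent of \<open>\<pi>/6\<close>, \<open>\<pi>/12\<close> or \<open>\<pi>/5\<close>.
\<close>

text \<open>Both bases are roots of \<open>r\<^sup>2 = r + 1\<close>, so their powers obey the Lucas
  recurrence.\<close>

lemma lucas_Binet:
  "real (lucas n) = ((1 + sqrt 5) / 2) ^ n + ((1 - sqrt 5) / 2) ^ n"
proof (induction n rule: lucas.induct)
  case (3 n)
  have step: "r ^ Suc (Suc n) = r ^ Suc n + r ^ n" if "r\<^sup>2 = r + 1" for r :: real
  proof -
    have "r ^ Suc (Suc n) = r\<^sup>2 * r ^ n"
      by (simp add: power2_eq_square)
    then show ?thesis
      by (simp add: that distrib_right)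
  qed
  have "((1 + sqrt 5) / 2)\<^sup>2 = (1 + sqrt 5) / 2 + 1" "((1 - sqrt 5) / 2)\<^sup>2 = (1 - sqrt 5) / 2 + 1"
    by (simp_all add: power2_eq_square field_simps)
  from this[THEN step] show ?case
    unfolding lucas.simps of_nat_add 3 by linarith
qed (simp_all add: field_simps)

lemma arctan_sums:
  fixes x :: real
  assumes "\<bar>x\<bar> \<le> 1"
  shows "(\<lambda>n. (-1) ^ n / (2 * real n + 1) * x ^ (2 * n + 1)) sums arctan x"
  using summable_arctan_series[OF assms] arctan_series[OF assms]
  by (simp add: sums_iff ac_simps)

text \<open>Here \<open>x\<close> is the root \<open>(s - (a + b)) / (2 * t)\<close> with its
  numerator rationalised, where \<open>s\<close> is the square root in the denominator. The bound
  \<open>t < 1\<close> puts \<open>a * x\<close> and \<open>b * x\<close> in (0, 1), where both the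
  arctan series and the addition formula apply.\<close>

lemma arctan_add_reciprocal_sums:
  fixes a b t :: real
  assumes pos: "0 < a" "0 < b" and ab: "a * b = 1" and t: "0 < t" "t < 1"
  defines "x \<equiv> 2 * t / ((a + b) + sqrt ((a + b)\<^sup>2 + 4 * t\<^sup>2))"
  shows "(\<lambda>n. (-1) ^ n / (2 * real n + 1) * (a ^ (2 * n + 1) + b ^ (2 * n + 1)) * x ^ (2 * n + 1))
           sums arctan t"
proof -
  define s where "s = sqrt ((a + b)\<^sup>2 + 4 * t\<^sup>2)"
  have s2: "s\<^sup>2 = (a + b)\<^sup>2 + 4 * t\<^sup>2"
    by (simp add: s_def)
  have "a + b \<le> s"
    unfolding s_def by (rule real_le_rsqrt) simp
  have x: "x = 2 * t / ((a + b) + s)"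
    by (simp add: x_def s_def)
  have x_pos: "0 < x"
    unfolding x using pos t \<open>a + b \<le> s\<close> by simp
  \<comment> \<open>To be used with \<open>c = a\<close> and \<open>c = b\<close>. Clearing the
    denominator leaves \<open>2 * c * t < (a + b) + s\<close>, and \<open>2 * c * t < 2 * c\<close>
    while both \<open>a + b\<close> and \<open>s\<close> are at least \<open>c\<close>.\<close>
  have bound: "c * x < 1" if "0 < c" "c \<le> a + b" for c
  proof -
    have "c * t < c * 1"
      using that t by (intro mult_strict_left_mono) auto
    then have "2 * c * t < (a + b) + s"
      using that \<open>a + b \<le> s\<close> by linarith
    then show ?thesis
      unfolding x using pos \<open>a + b \<le> s\<close> by (simp add: field_simps)
  qed
  have ax: "0 < a * x" "a * x < 1" and bx: "0 < b * x" "b * x < 1"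
    using x_pos pos bound by auto
  have root: "t * x\<^sup>2 + (a + b) * x = t"
  proof -
    \<comment> \<open>\<open>d\<close> is the denominator of \<open>x\<close>. Multiplying the claim
      by \<open>d\<^sup>2\<close> turns it into the quadratic equation satisfied by
      \<open>d\<close>, times \<open>t\<close>.\<close>
    define d where "d = (a + b) + s"
    have "d \<noteq> 0"
      using pos \<open>a + b \<le> s\<close> by (simp add: d_def)
    moreover have "d\<^sup>2 = 4 * t\<^sup>2 + 2 * (a + b) * d"
      using s2 by (simp add: d_def power2_eq_square algebra_simps)
    moreover have "d * x = 2 * t"
      using \<open>d \<noteq> 0\<close> by (simp add: x d_def)
    moreover have "(t * x\<^sup>2 + (a + b) * x) * d\<^sup>2 = t * (d * x)\<^sup>2 + (a + b) * (d * x) * d"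
      by (simp add: power2_eq_square algebra_simps)
    ultimately have "(t * x\<^sup>2 + (a + b) * x) * d\<^sup>2 = t * d\<^sup>2"
      by (simp add: power2_eq_square algebra_simps)
    with \<open>d \<noteq> 0\<close> show ?thesis
      by simp
  qed
  have abx: "(a * x) * (b * x) = x\<^sup>2"
    using ab by (simp add: power2_eq_square algebra_simps)
  have "x\<^sup>2 < 1"
    using mult_strict_mono[OF ax(2) bx(2)] ax bx abx by simp
  then have "(a * x + b * x) / (1 - (a * x) * (b * x)) = t"
    unfolding abx using root by (simp add: field_simps)
  then have "arctan (a * x) + arctan (b * x) = arctan t"
    using ax bx arctan_add[of "a * x" "b * x"] by simp
  moreover have "(\<lambda>n. (-1) ^ n / (2 * real n + 1) * (a * x) ^ (2 * n + 1) +
      (-1) ^ n / (2 * real n + 1) * (b * x) ^ (2 * n + 1)) sums (arctan (a * x) + arctan (b * x))"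
    using ax bx by (intro sums_add arctan_sums) auto
  ultimately show ?thesis
    unfolding power_mult_distrib by (simp only: ring_distribs mult.assoc)
qed

lemma lucas_arctan_sums:
  fixes t :: real
  assumes "0 < t" "t < 1"
  shows "(\<lambda>n. (-1) ^ n / (2 * real n + 1) * real (lucas (2 * m * (2 * n + 1))) *
            (2 * t / (real (lucas (2 * m)) + sqrt (real (lucas (2 * m)) ^ 2 + 4 * t ^ 2))) ^ (2 * n + 1))
         sums arctan t"
proof -
  define a b :: real where "a = ((1 + sqrt 5) / 2) ^ (2 * m)" and "b = ((1 - sqrt 5) / 2) ^ (2 * m)"
  have L: "real (lucas (2 * m * k)) = a ^ k + b ^ k" for k
    unfolding lucas_Binet a_def b_def power_mult ..
  \<comment> \<open>The even exponent matters here: the two roots multiply to -1, which only an even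
    power turns into 1. Positivity of \<open>b\<close> then follows from that of
    \<open>a\<close>.\<close>
  have "a * b = (((1 + sqrt 5) / 2) * ((1 - sqrt 5) / 2)) ^ (2 * m)"
    unfolding a_def b_def by (rule power_mult_distrib[symmetric])
  also have "((1 + sqrt 5) / 2) * ((1 - sqrt 5) / 2) = - 1"
    by (simp add: field_simps)
  finally have ab: "a * b = 1" by simp
  have "0 < a"
    unfolding a_def by (intro zero_less_power divide_pos_pos add_pos_pos) simp_all
  moreover from this ab have "0 < b"
    by (metis zero_less_mult_pos zero_less_one)
  ultimately have "(\<lambda>n. (-1) ^ n / (2 * real n + 1) * (a ^ (2 * n + 1) + b ^ (2 * n + 1)) *
      (2 * t / ((a + b) + sqrt ((a + b)\<^sup>2 + 4 * t\<^sup>2))) ^ (2 * n + 1)) sums arctan t"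
    using ab assms by (intro arctan_add_reciprocal_sums)
  moreover have "real (lucas (2 * m)) = a + b"
    using L[of 1] by simp
  ultimately show ?thesis
    by (simp only: L)
qed

lemma tan_pi_12: "tan (pi / 12) = 2 - sqrt 3"
proof -
  have "cos (pi / 3 - pi / 4) \<noteq> 0"
    using cos_gt_zero[of "pi / 12"] by simp
  have "tan (pi / 12) = tan (pi / 3 - pi / 4)"
    by simp
  also have "\<dots> = (sqrt 3 - 1) / (1 + sqrt 3)"
    by (subst tan_diff[OF _ _ \<open>cos (pi / 3 - pi / 4) \<noteq> 0\<close>])
      (simp_all add: tan_60 tan_45 cos_60 cos_45)
  also have "\<dots> = 2 - sqrt 3"
    using real_sqrt_ge_zero[of 3] by (simp add: field_simps add_nonneg_eq_0_iff)
  finally show ?thesis .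
qed

text \<open>Since 2 pi/5 and 3 pi/5 add up to pi, their sines agree. Expanding both and cancelling
  \<open>sin (pi / 5)\<close> leaves a quadratic equation for the cosine.\<close>

lemma cos_pi_5: "cos (pi / 5) = (1 + sqrt 5) / 4"
proof -
  define c s where "c = cos (pi / 5)" and "s = sin (pi / 5)"
  have s: "s > 0"
    unfolding s_def by (auto intro!: sin_gt_zero)
  have s2: "s\<^sup>2 = 1 - c\<^sup>2"
    by (simp add: c_def s_def sin_squared_eq)
  have "sin (2 * (pi / 5)) = sin (pi - 2 * (pi / 5))"
    by (rule sin_pi_minus[symmetric])
  also have "pi - 2 * (pi / 5) = 2 * (pi / 5) + pi / 5"
    by simp
  finally have "s * (2 * c) = s * (4 * c\<^sup>2 - 1)"
    unfolding sin_add sin_double cos_double c_def[symmetric] s_def[symmetric] s2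
    by (simp add: power2_eq_square algebra_simps)
  then have "2 * c = 4 * c\<^sup>2 - 1"
    using s by simp
  then have "(4 * c - 1)\<^sup>2 = 5"
    by (simp add: power2_eq_square algebra_simps)
  then have "\<bar>4 * c - 1\<bar> = sqrt 5"
    by (metis real_sqrt_abs)
  \<comment> \<open>This selects the positive root: it makes \<open>4 * c - 1\<close>
    positive.\<close>
  moreover have "1 / 2 \<le> c"
    using cos_monotone_0_pi_le[of "pi / 5" "pi / 3"] by (simp add: c_def cos_60)
  ultimately show ?thesis
    unfolding c_def[symmetric] by simp
qed

text \<open>The squared tangent is the squared secant minus 1, and the secant is known from
  \<open>cos_pi_5\<close>; the sign of the tangent fixes the square root.\<close>

lemma tan_pi_5: "tan (pi / 5) = sqrt (5 - 2 * sqrt 5)"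
proof (rule real_sqrt_unique[symmetric])
  have c: "cos (pi / 5) \<noteq> 0"
    using cos_gt_zero[of "pi / 5"] by simp
  have "(tan (pi / 5))\<^sup>2 = inverse ((cos (pi / 5))\<^sup>2) - 1"
    using tan_sec[OF c] by (simp add: power_inverse)
  also have "inverse ((cos (pi / 5))\<^sup>2) = 6 - 2 * sqrt 5"
    unfolding cos_pi_5 by (rule inverse_unique) (simp add: power2_eq_square field_simps)
  also have "\<dots> - 1 = 5 - 2 * sqrt 5"
    by simp
  finally show "(tan (pi / 5))\<^sup>2 = 5 - 2 * sqrt 5" .
  show "0 \<le> tan (pi / 5)"
    using tan_gt_zero[of "pi / 5"] by simp
qed

theorem theorem5:
  fixes m :: nat
  shows "((\<lambda>n. (-1) ^ n / (2 * real n + 1) * real (lucas (2 * m * (2 * n + 1))) *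
            (2 / (sqrt 3 * real (lucas (2 * m)) + sqrt (3 * real (lucas (2 * m)) ^ 2 + 4))) ^ (2 * n + 1))
         sums (pi / 6)) \<and>
         ((\<lambda>n. (-1) ^ n / (2 * real n + 1) * real (lucas (2 * m * (2 * n + 1))) *
            (2 * (2 - sqrt 3) /
              (real (lucas (2 * m)) + sqrt (real (lucas (2 * m)) ^ 2 + 4 * (2 - sqrt 3) ^ 2))) ^ (2 * n + 1))
         sums (pi / 12)) \<and>
         ((\<lambda>n. (-1) ^ n / (2 * real n + 1) * real (lucas (2 * m * (2 * n + 1))) *
            (2 * sqrt (5 - 2 * sqrt 5) /
              (real (lucas (2 * m)) + sqrt (real (lucas (2 * m)) ^ 2 + 4 * (5 - 2 * sqrt 5)))) ^ (2 * n + 1))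
         sums (pi / 5))"
proof -
  \<comment> \<open>All three angles lie below \<open>pi / 4\<close>, which is exactly what gives
    \<open>tan y < 1\<close>.\<close>
  have main: "(\<lambda>n. (-1) ^ n / (2 * real n + 1) * real (lucas (2 * m * (2 * n + 1))) *
      (2 * tan y / (real (lucas (2 * m)) + sqrt (real (lucas (2 * m)) ^ 2 + 4 * tan y ^ 2))) ^ (2 * n + 1))
      sums y" if "0 < y" "y < pi / 4" for y
  proof -
    have "0 < tan y" "tan y < 1" "arctan (tan y) = y"
      using that tan_gt_zero[of y] tan_monotone[of y "pi / 4"] by (auto simp: tan_45 arctan_tan)
    then show ?thesis
      using lucas_arctan_sums[of "tan y" m] by simp
  qed
  \<comment> \<open>As \<open>tan (pi / 6) = 1 / sqrt 3\<close>, expanding the fraction by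
    \<open>sqrt 3\<close> gives the stated form.\<close>
  have "2 * tan (pi / 6) / (L + sqrt (L\<^sup>2 + 4 * (tan (pi / 6))\<^sup>2))
      = 2 / (sqrt 3 * L + sqrt (3 * L\<^sup>2 + 4))" for L :: real
  proof -
    have "sqrt (3 * L\<^sup>2 + 4) = sqrt 3 * sqrt (L\<^sup>2 + 4 * (1 / sqrt 3)\<^sup>2)"
      by (simp add: real_sqrt_mult[symmetric] power_divide algebra_simps)
    then show ?thesis
      by (simp add: tan_30 distrib_left[symmetric])
  qed
  \<comment> \<open>The radicand is nonnegative because its square root is the positive number
    \<open>tan (pi / 5)\<close>.\<close>
  moreover have "(sqrt (5 - 2 * sqrt 5))\<^sup>2 = 5 - 2 * sqrt 5"
    using tan_gt_zero[of "pi / 5"] unfolding tan_pi_5 by simp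
  ultimately show ?thesis
    using main[of "pi / 6"] main[of "pi / 12"] main[of "pi / 5"]
    by (simp add: tan_pi_12 tan_pi_5)
qed

end
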